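(* The center $C(\widetilde{\mathfrak{sv}})$ of the extended Schrödinger-Virasoro Lie algebra $\widetilde{\mathfrak{sv}}$ is zero: $C(\widetilde{\mathfrak{sv}})=\{0\}$.
   Context: The extended Schrödinger-Virasoro Lie algebra $\widetilde{\mathfrak{sv}}$ is the complex Lie algebra with basis $\{L_n, M_n, N_n, Y_{n+\frac12} \mid n\in\mathbb{Z}\}$ and brackets, for all $m,n\in\mathbb{Z}$: $[L_m,L_n]=(n-m)L_{m+n}$, $[M_m,M_n]=0$, $[N_m,N_n]=0$, $[Y_{m+\frac12},Y_{n+\frac12}]=(m-n)M_{m+n+1}$, $[L_m,M_n]=nM_{m+n}$, $[L_m,N_n]=nN_{m+n}$, $[L_m,Y_{n+\frac12}]=\left(n+\frac{1-m}{2}\right)Y_{m+n+\frac12}$, $[N_m,M_n]=2M_{m+n}$, $[N_m,Y_{n+\frac12}]=Y_{m+n+\frac12}$, $[M_m,Y_{n+\frac12}]=0$. *)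

theory Defs
  imports Complex_Main "HOL-Library.Poly_Mapping"
begin

locale lie_algebra = vector_space scale
  for scale :: "'k::field \<Rightarrow> 'v::ab_group_add \<Rightarrow> 'v" +
  fixes bracket :: "'v \<Rightarrow> 'v \<Rightarrow> 'v"
  assumes linear_left: "Vector_Spaces.linear scale scale (\<lambda>x. bracket x y)"
    and linear_right: "Vector_Spaces.linear scale scale (\<lambda>y. bracket x y)"
    and alternating: "bracket x x = 0"
    and jacobi: "bracket x (bracket y z) + bracket y (bracket z x) + bracket z (bracket x y) = 0"
begin

definition center :: "'v set"
  where "center = {x. \<forall>y. bracket x y = 0}"

end

text \<open>The constructor \<open>Y n\<close> stands for the basis vector $Y_{n+1/2}$.\<close>

datatype sv_index = L int | M int | N int | Y int

text \<open>The underlying space is the free complex vector space on \<open>sv_index\<close>; the basis vectors are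
  \<open>Poly_Mapping.single i 1\<close>.\<close>

type_synonym sv_ext = "sv_index \<Rightarrow>\<^sub>0 complex"

definition sv_scale :: "complex \<Rightarrow> sv_ext \<Rightarrow> sv_ext"
  where "sv_scale c x = Poly_Mapping.map ((*) c) x"

text \<open>The six equations with the arguments in the order opposite to the usual presentation
  are the ones forced by antisymmetry.\<close>

fun sv_basis_bracket :: "sv_index \<Rightarrow> sv_index \<Rightarrow> sv_ext" where
  "sv_basis_bracket (L m) (L n) = Poly_Mapping.single (L (m + n)) (of_int (n - m))"
| "sv_basis_bracket (M m) (M n) = 0"
| "sv_basis_bracket (N m) (N n) = 0"
| "sv_basis_bracket (Y m) (Y n) = Poly_Mapping.single (M (m + n + 1)) (of_int (m - n))"
| "sv_basis_bracket (L m) (M n) = Poly_Mapping.single (M (m + n)) (of_int n)"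
| "sv_basis_bracket (L m) (N n) = Poly_Mapping.single (N (m + n)) (of_int n)"
| "sv_basis_bracket (L m) (Y n) =
     Poly_Mapping.single (Y (m + n)) (of_int n + (1 - of_int m) / 2)"
| "sv_basis_bracket (N m) (M n) = Poly_Mapping.single (M (m + n)) 2"
| "sv_basis_bracket (N m) (Y n) = Poly_Mapping.single (Y (m + n)) 1"
| "sv_basis_bracket (M m) (Y n) = 0"
| "sv_basis_bracket (M n) (L m) = - Poly_Mapping.single (M (m + n)) (of_int n)"
| "sv_basis_bracket (N n) (L m) = - Poly_Mapping.single (N (m + n)) (of_int n)"
| "sv_basis_bracket (Y n) (L m) =
     - Poly_Mapping.single (Y (m + n)) (of_int n + (1 - of_int m) / 2)"
| "sv_basis_bracket (M n) (N m) = - Poly_Mapping.single (M (m + n)) 2"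
| "sv_basis_bracket (Y n) (N m) = - Poly_Mapping.single (Y (m + n)) 1"
| "sv_basis_bracket (Y n) (M m) = 0"

text \<open>Bilinear extension of the bracket from the basis.\<close>

definition sv_bracket :: "sv_ext \<Rightarrow> sv_ext \<Rightarrow> sv_ext"
  where "sv_bracket x y =
    (\<Sum>i\<in>Poly_Mapping.keys x. \<Sum>j\<in>Poly_Mapping.keys y.
      sv_scale (Poly_Mapping.lookup x i * Poly_Mapping.lookup y j) (sv_basis_bracket i j))"

lemma lookup_sv_scale [simp]: "Poly_Mapping.lookup (sv_scale c x) i = c * Poly_Mapping.lookup x i"
  by (simp add: sv_scale_def Poly_Mapping.map.rep_eq when_def)

lemma sv_scale_add_left: "sv_scale (c + d) x = sv_scale c x + sv_scale d x"
  by (rule poly_mapping_eqI) (simp add: lookup_add algebra_simps)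

lemma sv_scale_add_right: "sv_scale c (x + y) = sv_scale c x + sv_scale c y"
  by (rule poly_mapping_eqI) (simp add: lookup_add algebra_simps)

lemma sv_scale_scale [simp]: "sv_scale c (sv_scale d x) = sv_scale (c * d) x"
  by (rule poly_mapping_eqI) simp

lemma sv_scale_zero [simp]: "sv_scale 0 x = 0" "sv_scale c 0 = 0"
  by (rule poly_mapping_eqI; simp)+

lemma sv_scale_single [simp]:
  "sv_scale c (Poly_Mapping.single i d) = Poly_Mapping.single i (c * d)"
  by (rule poly_mapping_eqI) (simp add: lookup_single when_def)

lemma sv_scale_minus [simp]: "sv_scale c (- x) = - sv_scale c x"
  by (rule poly_mapping_eqI) simp

lemma sv_scale_sum: "sv_scale c (sum f A) = (\<Sum>a\<in>A. sv_scale c (f a))"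
  by (induction A rule: infinite_finite_induct) (simp_all add: sv_scale_add_right)

interpretation sv_space: vector_space sv_scale
  by unfold_locales (simp_all add: sv_scale_add_left sv_scale_add_right, rule poly_mapping_eqI, simp)

lemma sv_bracket_superset:
  assumes "finite A" "finite B" "Poly_Mapping.keys x \<subseteq> A" "Poly_Mapping.keys y \<subseteq> B"
  shows "sv_bracket x y = (\<Sum>i\<in>A. \<Sum>j\<in>B.
      sv_scale (Poly_Mapping.lookup x i * Poly_Mapping.lookup y j) (sv_basis_bracket i j))"
proof -
  have "sv_bracket x y = (\<Sum>i\<in>Poly_Mapping.keys x. \<Sum>j\<in>B.
      sv_scale (Poly_Mapping.lookup x i * Poly_Mapping.lookup y j) (sv_basis_bracket i j))"
    unfolding sv_bracket_def
    by (intro sum.cong refl sum.mono_neutral_left) (use assms in \<open>auto simp: in_keys_iff\<close>)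
  also have "\<dots> = (\<Sum>i\<in>A. \<Sum>j\<in>B.
      sv_scale (Poly_Mapping.lookup x i * Poly_Mapping.lookup y j) (sv_basis_bracket i j))"
    by (intro sum.mono_neutral_left) (use assms in \<open>auto simp: in_keys_iff\<close>)
  finally show ?thesis .
qed

lemma sv_bracket_add_left: "sv_bracket (x + x') y = sv_bracket x y + sv_bracket x' y"
proof -
  let ?A = "Poly_Mapping.keys x \<union> Poly_Mapping.keys x'" and ?B = "Poly_Mapping.keys y"
  have "Poly_Mapping.keys (x + x') \<subseteq> ?A"
    by (rule Poly_Mapping.keys_add)
  then show ?thesis
    using sv_bracket_superset[of ?A ?B "x + x'" y] sv_bracket_superset[of ?A ?B x y]
      sv_bracket_superset[of ?A ?B x' y]
    by (simp add: lookup_add distrib_right sv_scale_add_left sum.distrib)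
qed

lemma sv_bracket_add_right: "sv_bracket x (y + y') = sv_bracket x y + sv_bracket x y'"
proof -
  let ?B = "Poly_Mapping.keys y \<union> Poly_Mapping.keys y'" and ?A = "Poly_Mapping.keys x"
  have "Poly_Mapping.keys (y + y') \<subseteq> ?B"
    by (rule Poly_Mapping.keys_add)
  then show ?thesis
    using sv_bracket_superset[of ?A ?B x "y + y'"] sv_bracket_superset[of ?A ?B x y]
      sv_bracket_superset[of ?A ?B x y']
    by (simp add: lookup_add distrib_left sv_scale_add_left sum.distrib)
qed

lemma keys_sv_scale: "Poly_Mapping.keys (sv_scale c x) \<subseteq> Poly_Mapping.keys x"
  by (auto simp: in_keys_iff)

lemma sv_bracket_scale_left [simp]: "sv_bracket (sv_scale c x) y = sv_scale c (sv_bracket x y)"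
  using sv_bracket_superset[of "Poly_Mapping.keys x" "Poly_Mapping.keys y" "sv_scale c x" y]
  by (simp add: keys_sv_scale sv_bracket_def sv_scale_sum mult.assoc)

lemma sv_bracket_scale_right [simp]: "sv_bracket x (sv_scale c y) = sv_scale c (sv_bracket x y)"
  using sv_bracket_superset[of "Poly_Mapping.keys x" "Poly_Mapping.keys y" x "sv_scale c y"]
  by (simp add: keys_sv_scale sv_bracket_def sv_scale_sum mult_ac)

lemma sv_bracket_zero [simp]: "sv_bracket 0 x = 0" "sv_bracket x 0 = 0"
  by (simp_all add: sv_bracket_def)

lemma sv_bracket_minus [simp]: "sv_bracket (- x) y = - sv_bracket x y"
    "sv_bracket x (- y) = - sv_bracket x y"
  by (metis add.inverse_unique add.right_inverse sv_bracket_add_left sv_bracket_zero(1),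
      metis add.inverse_unique add.right_inverse sv_bracket_add_right sv_bracket_zero(2))

lemma sv_bracket_single:
  "sv_bracket (Poly_Mapping.single i c) (Poly_Mapping.single j d) =
    sv_scale (c * d) (sv_basis_bracket i j)"
  using sv_bracket_superset[of "{i}" "{j}" "Poly_Mapping.single i c" "Poly_Mapping.single j d"]
  by (simp add: lookup_single)

lemma sv_ext_expand:
  "x = (\<Sum>i\<in>Poly_Mapping.keys x. Poly_Mapping.single i (Poly_Mapping.lookup x i))"
  for x :: sv_ext
  by (rule poly_mapping_eqI)
    (auto simp: lookup_sum lookup_single when_def in_keys_iff sum.delta)

lemma sv_ext_induct [case_names add single]:
  assumes "\<And>x y. P x \<Longrightarrow> P y \<Longrightarrow> P (x + y)" "\<And>i c. P (Poly_Mapping.single i c)"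
  shows "P (x :: sv_ext)"
proof -
  have 0: "P 0"
    using assms(2)[of undefined 0] by simp
  have "P (\<Sum>i\<in>A. Poly_Mapping.single i (Poly_Mapping.lookup x i))" for A
    by (induction A rule: infinite_finite_induct) (simp_all add: 0 assms)
  then show ?thesis
    using sv_ext_expand[of x] by metis
qed

lemma sv_basis_bracket_antisym: "sv_basis_bracket i j = - sv_basis_bracket j i"
  by (cases i; cases j; simp flip: single_uminus add: ac_simps)

lemma sv_bracket_antisym: "sv_bracket x y = - sv_bracket y x"
proof (induction x rule: sv_ext_induct)
  case (add x x')
  then show ?case
    by (simp add: sv_bracket_add_left sv_bracket_add_right)
next
  case (single i c)
  then show ?case
  proof (induction y rule: sv_ext_induct)
    case (add y y')
    then show ?case
      by (simp add: sv_bracket_add_left sv_bracket_add_right)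
  next
    case (single j d)
    then show ?case
      using sv_basis_bracket_antisym[of i j] by (simp add: sv_bracket_single mult.commute)
  qed
qed

lemma sv_bracket_jacobi_single:
  fixes i j k :: sv_index and a b c :: complex
  defines "x \<equiv> Poly_Mapping.single i a" and "y \<equiv> Poly_Mapping.single j b"
    and "z \<equiv> Poly_Mapping.single k c"
  shows "sv_bracket x (sv_bracket y z) + sv_bracket y (sv_bracket z x)
    + sv_bracket z (sv_bracket x y) = 0"
  unfolding x_def y_def z_def
  by (cases i; cases j; cases k;
      simp add: sv_bracket_single ac_simps flip: single_uminus single_add;
      simp add: field_simps)

lemma sv_bracket_jacobi:
  "sv_bracket x (sv_bracket y z) + sv_bracket y (sv_bracket z x)
    + sv_bracket z (sv_bracket x y) = 0"
proof -
  define J where "J x y z = sv_bracket x (sv_bracket y z) + sv_bracket y (sv_bracket z x)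
    + sv_bracket z (sv_bracket x y)" for x y z
  have add: "J (x + x') y z = J x y z + J x' y z" "J x (y + y') z = J x y z + J x y' z"
    "J x y (z + z') = J x y z + J x y z'" for x x' y y' z z'
    by (simp_all add: J_def sv_bracket_add_left sv_bracket_add_right algebra_simps)
  have 1: "J (Poly_Mapping.single i a) (Poly_Mapping.single j b) z = 0" for i a j b
    by (induction z rule: sv_ext_induct) (simp_all add: add, simp add: J_def sv_bracket_jacobi_single)
  have 2: "J (Poly_Mapping.single i a) y z = 0" for i a
    by (induction y rule: sv_ext_induct) (simp_all add: add 1)
  have "J x y z = 0"
    by (induction x rule: sv_ext_induct) (simp_all add: add 2)
  then show ?thesis
    by (simp add: J_def)
qed

lemma sv_basis:
  "inj (\<lambda>i. Poly_Mapping.single i (1::complex) :: sv_ext)"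
  "sv_space.independent (range (\<lambda>i. Poly_Mapping.single i 1))"
  "sv_space.span (range (\<lambda>i. Poly_Mapping.single i 1)) = UNIV"
proof -
  let ?e = "\<lambda>i. Poly_Mapping.single i 1 :: sv_ext"
  show inj: "inj ?e"
    by (rule injI) (metis lookup_single_eq lookup_single_not_eq zero_neq_one)
  show "sv_space.independent (range ?e)"
    unfolding sv_space.independent_explicit_finite_subsets
  proof (intro allI impI ballI)
    fix A u v
    assume A: "A \<subseteq> range ?e" "finite A" and 0: "(\<Sum>w\<in>A. sv_scale (u w) w) = 0" and "v \<in> A"
    then obtain i where i: "v = ?e i" by blast
    have "Poly_Mapping.lookup (sv_scale (u w) w) i = (if w = v then u w else 0)" if "w \<in> A" for w
    proof -
      obtain j where "w = ?e j" using \<open>w \<in> A\<close> A(1) by blast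
      then show ?thesis
        using inj i by (cases "i = j") (auto simp: lookup_single when_def dest: injD)
    qed
    then have "Poly_Mapping.lookup (\<Sum>w\<in>A. sv_scale (u w) w) i = (\<Sum>w\<in>A. if w = v then u w else 0)"
      unfolding lookup_sum by (rule sum.cong[OF refl])
    then show "u v = 0"
      using 0 A(2) \<open>v \<in> A\<close> by (simp add: sum.delta)
  qed
  have "x \<in> sv_space.span (range ?e)" for x
  proof (induction x rule: sv_ext_induct)
    case (add x y)
    then show ?case by (rule sv_space.span_add)
  next
    case (single i c)
    have "sv_scale c (?e i) \<in> sv_space.span (range ?e)"
      by (intro sv_space.span_scale sv_space.span_base rangeI)
    then show ?case by simp
  qed
  then show "sv_space.span (range ?e) = UNIV" by blast
qed

interpretation sv: lie_algebra sv_scale sv_bracket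
proof
  fix x :: sv_ext
  have "Poly_Mapping.lookup (sv_bracket x x) i = 0" for i
    using arg_cong[OF sv_bracket_antisym[of x x], of "\<lambda>f. Poly_Mapping.lookup f i"] by simp
  then show "sv_bracket x x = 0"
    by (simp add: poly_mapping_eqI)
qed (simp_all add: sv_bracket_add_left sv_bracket_add_right sv_bracket_jacobi)

end

theory Submission
  imports Defs
begin

text \<open>Bracketing with the basis vectors \<open>N 1\<close>, \<open>N 0\<close> and \<open>M 0\<close> detects every
  coordinate of \<open>x\<close> separately: $[L_n, N_1] = N_{n+1}$ is the only source of \<open>N\<close>-terms in
  $[x, N_1]$, bracketing with $N_0$ is diagonal with eigenvalue $-2$ on each $M_n$ and $-1$ on each
  $Y_{n+1/2}$, and $[N_n, M_0] = 2 M_n$ while $[L_n, M_0] = 0$. So a central element has no nonzero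
  coordinate.\<close>

lemma lookup_sv_bracket_single:
  "Poly_Mapping.lookup (sv_bracket x (Poly_Mapping.single j 1)) k =
    (\<Sum>i\<in>Poly_Mapping.keys x.
      Poly_Mapping.lookup x i * Poly_Mapping.lookup (sv_basis_bracket i j) k)"
  using sv_bracket_superset[of "Poly_Mapping.keys x" "{j}" x "Poly_Mapping.single j 1"]
  by (simp add: lookup_sum)

text \<open>Only \<open>i\<close> contributes to the coordinate \<open>k\<close> of the bracket of
  \<open>x\<close> with the basis vector \<open>j\<close>, so this coordinate is $x_i$ times a
  nonzero constant, and centrality makes it 0.\<close>

lemma center_lookup_eq_0:
  assumes "x \<in> sv.center"
    and only: "\<And>i'. i' \<noteq> i \<Longrightarrow> Poly_Mapping.lookup (sv_basis_bracket i' j) k = 0"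
    and nz: "Poly_Mapping.lookup (sv_basis_bracket i j) k \<noteq> 0"
  shows "Poly_Mapping.lookup x i = 0"
proof (rule ccontr)
  \<comment> \<open>This puts \<open>i\<close> among the keys of \<open>x\<close>, so the sum over
    the keys collapses to \<open>{i}\<close>.\<close>
  assume i: "Poly_Mapping.lookup x i \<noteq> 0"
  have "0 = Poly_Mapping.lookup (sv_bracket x (Poly_Mapping.single j 1)) k"
    using assms(1) by (simp add: sv.center_def)
  also have "\<dots> = (\<Sum>i'\<in>{i}.
      Poly_Mapping.lookup x i' * Poly_Mapping.lookup (sv_basis_bracket i' j) k)"
    unfolding lookup_sv_bracket_single
    by (rule sum.mono_neutral_right) (use i only in \<open>auto simp: in_keys_iff\<close>)
  finally show False
    using i nz by simp
qed

theorem lemma2p10: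
  shows "sv.center = {0}"
proof -
  have "Poly_Mapping.lookup x i = 0" if x: "x \<in> sv.center" for x i
  proof (cases i)
    case (L n)
    \<comment> \<open>\<open>N 0\<close> would fail here, since $[L_n, N_0] = 0$.\<close>
    have "Poly_Mapping.lookup (sv_basis_bracket i' (N 1)) (N (n + 1)) = 0" if "i' \<noteq> L n" for i'
      using that by (cases i') (auto simp: lookup_single when_def)
    then show ?thesis
      unfolding L by (rule center_lookup_eq_0[OF x]) simp_all
  next
    case (M n)
    have "Poly_Mapping.lookup (sv_basis_bracket i' (N 0)) (M n) = 0" if "i' \<noteq> M n" for i'
      using that by (cases i') (auto simp: lookup_single when_def)
    then show ?thesis
      unfolding M by (rule center_lookup_eq_0[OF x]) simp_all
  next
    case (N n)
    \<comment> \<open>For nonzero j, bracketing with \<open>M j\<close> would send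
      \<open>L n\<close> to the same coordinate as \<open>N n\<close>.\<close>
    have "Poly_Mapping.lookup (sv_basis_bracket i' (M 0)) (M n) = 0" if "i' \<noteq> N n" for i'
      using that by (cases i') (auto simp: lookup_single when_def)
    then show ?thesis
      unfolding N by (rule center_lookup_eq_0[OF x]) simp_all
  next
    case (Y n)
    have "Poly_Mapping.lookup (sv_basis_bracket i' (N 0)) (Y n) = 0" if "i' \<noteq> Y n" for i'
      using that by (cases i') (auto simp: lookup_single when_def)
    then show ?thesis
      unfolding Y by (rule center_lookup_eq_0[OF x]) simp_all
  qed
  then have "x = 0" if "x \<in> sv.center" for x
    using that by (intro poly_mapping_eqI) simp
  moreover have "0 \<in> sv.center"
    by (simp add: sv.center_def)
  ultimately show ?thesis
    by blast
qed

end
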